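(* Let $L>0$ and $m\ge1$. Let $a\in L^\infty(0,L)$ be such that there exist constants $0<\alpha<\beta$ with $\alpha\le a(x)\le\beta$ for a.e. $x\in(0,L)$, let $g\in L^m(0,L)$, and let $\phi:\mathbb{R}\to\mathbb{R}\cup\{+\infty\}$ be continuous with values in $\mathbb{R}\cup\{+\infty\}$ with $\phi(s)<+\infty$ for every $s\ne0$. Assume that there exists a weak solution $u$ of the problem $$-\frac{d}{dx}\left(a(x)\frac{du}{dx}\right)=-\frac{d\phi(u)}{dx}-\frac{dg(x)}{dx}\ \text{ in }(0,L),\qquad u(0)=u(L)=0,$$ in the sense of Definition $1$ if $m=1$ or in the sense of Definition $m$ if $m>1$ (equivalently, $u\in W^{1,m}_0(0,L)$, $\phi(u)\in L^m(0,L)$, and the equation holds in $\mathcal{D}'(0,L)$). Fix any sequence $\phi_n$ of reasonable approximations of $\phi$, and assume that it satisfies the domination condition $$\exists\,C\in\mathbb{R}\ \text{ such that }\ |\phi_n(s)|\le C|\phi(s)|\quad\forall s\in\mathbb{R},\ \forall n\in\mathbb{N}.$$ Then there exists a sequence $g_n\in L^m(0,L)$ with $g_n\to g$ strongly in $L^m(0,L)$, for which there exists, for every $n$, a weak solution $u_n$ of the problem $$-\frac{d}{dx}\left(a(x)\frac{du_n}{dx}\right)=-\frac{d\phi_n(u_n)}{dx}-\frac{dg_n(x)}{dx}\ \text{ in }(0,L),\qquad u_n(0)=u_n(L)=0,$$ for the data $(a,g_n,\phi_n)$, in the sense of Definition $1$ if $m=1$ or in the sense of Definition $m$ if $m>1$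 (equivalently, $u_n\in W^{1,m}_0(0,L)$, $\phi_n(u_n)\in L^m(0,L)$, and the equation holds in $\mathcal{D}'(0,L)$), such that $$u_n\not\equiv u\quad\forall n,\qquad u_n\to u\ \text{ strongly in }W^{1,m}_0(0,L).$$
   Context: $\mathbb{R}\cup\{+\infty\}$ carries its usual topology (neighbourhoods of $+\infty$ contain some $(M,+\infty]$). Elements of $W^{1,1}_0(0,L)$ are identified with their continuous representatives on $[0,L]$, and $\phi(u)$ denotes the function $x\mapsto\phi(u(x))$. Weak solution for data $(a,g,\phi)$ in the sense of Definition $1$ (for $m=1$): a function $u$ such that $u\in W^{1,1}_0(0,L)$, $\phi(u)\in L^1(0,L)$, and $$\int_0^L a(x)\frac{du}{dx}\frac{dz}{dx}\,dx=\int_0^L\phi(u)\frac{dz}{dx}\,dx+\int_0^L g(x)\frac{dz}{dx}\,dx$$ for every Lipschitz function $z$ on $(0,L)$ with $z(0)=z(L)=0$. Weak solution in the sense of Definition $m$ (for $m>1$): a function $u$ such that $u\in W^{1,m}_0(0,L)$, $\phi(u)\in L^m(0,L)$, and the same identity holds for every $z\in W^{1,m'}_0(0,L)$, where $m'=\frac{m}{m-1}$. Sequence of reasonable approximations of $\phi$: a sequence of functions $\phi_n:\mathbb{R}\to\mathbb{R}\cup\{+\infty\}$ such that, for every $n$, $\phi_n$ is continuous with values in $\mathbb{R}\cup\{+\infty\}$ and $\phi_n(s)<+\infty$ for every $s\neq0$; and such that for every sequence $s_n\in\mathbb{R}$ and every $s\in\mathbb{R}$ with $s_n\to s$ in $\mathbb{R}$,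 one has $\phi_n(s_n)\to\phi(s)$ in $\mathbb{R}\cup\{+\infty\}$. *)

theory Defs
  imports "HOL-Analysis.Analysis"
begin

abbreviation leb_interval :: "real \<Rightarrow> real measure" where
  "leb_interval L \<equiv> lebesgue_on {0<..<L}"

text \<open>Elements of the Lebesgue spaces are represented by functions; equality in these spaces is
  equality almost everywhere on the interval from 0 to L.\<close>

definition Lp_space :: "real \<Rightarrow> real \<Rightarrow> (real \<Rightarrow> real) set" where
  "Lp_space L p = {f. f \<in> borel_measurable (leb_interval L) \<and>
     integrable (leb_interval L) (\<lambda>x. \<bar>f x\<bar> powr p)}"

definition Lp_norm :: "real \<Rightarrow> real \<Rightarrow> (real \<Rightarrow> real) \<Rightarrow> real" where
  "Lp_norm L p f = (LINT x|leb_interval L. \<bar>f x\<bar> powr p) powr (1 / p)"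

definition Linf_space :: "real \<Rightarrow> (real \<Rightarrow> real) set" where
  "Linf_space L = {f. f \<in> borel_measurable (leb_interval L) \<and>
     (\<exists>K. AE x in leb_interval L. \<bar>f x\<bar> \<le> K)}"

definition Lp_space_ereal :: "real \<Rightarrow> real \<Rightarrow> (real \<Rightarrow> ereal) set" where
  "Lp_space_ereal L p = {f. (AE x in leb_interval L. \<bar>f x\<bar> \<noteq> \<infinity>) \<and>
     (\<lambda>x. real_of_ereal (f x)) \<in> Lp_space L p}"

text \<open>Smooth functions with compact support in the open interval, extended by zero to the
  real line.\<close>

definition test_functions :: "real \<Rightarrow> (real \<Rightarrow> real) set" where
  "test_functions L = {\<psi>. (\<forall>k x. (deriv ^^ k) \<psi> differentiable (at x)) \<and>
     (\<exists>K. compact K \<and> K \<subseteq> {0<..<L} \<and> (\<forall>x. x \<notin> K \<longrightarrow> \<psi> x = 0))}"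

definition L1_loc :: "real \<Rightarrow> (real \<Rightarrow> real) set" where
  "L1_loc L = {f. \<forall>K. compact K \<and> K \<subseteq> {0<..<L} \<longrightarrow> set_integrable lebesgue K f}"

text \<open>The weak derivative is a relation, since it is determined only almost everywhere.\<close>

definition has_weak_derivative :: "real \<Rightarrow> (real \<Rightarrow> real) \<Rightarrow> (real \<Rightarrow> real) \<Rightarrow> bool" where
  "has_weak_derivative L u v \<longleftrightarrow> u \<in> L1_loc L \<and> v \<in> L1_loc L \<and>
     (\<forall>\<psi>\<in>test_functions L.
        (LINT x|leb_interval L. u x * deriv \<psi> x) = - (LINT x|leb_interval L. v x * \<psi> x))"

text \<open>The norm of \<open>u\<close> in \<open>W\<^sup>1\<^sup>,\<^sup>p(0,L)\<close>, where \<open>v\<close> is the weak derivative of \<open>u\<close>.\<close>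

definition sobolev_norm :: "real \<Rightarrow> real \<Rightarrow> (real \<Rightarrow> real) \<Rightarrow> (real \<Rightarrow> real) \<Rightarrow> real" where
  "sobolev_norm L p u v = Lp_norm L p u + Lp_norm L p v"

text \<open>\<open>W\<^sup>1\<^sup>,\<^sup>p\<^sub>0(0,L)\<close> is the closure of the test functions in \<open>W\<^sup>1\<^sup>,\<^sup>p(0,L)\<close>.  Its elements are
  represented by their continuous representatives on \<open>[0,L]\<close>, which then vanish at both end points;
  the values outside \<open>[0,L]\<close> are irrelevant.\<close>

definition W0_space :: "real \<Rightarrow> real \<Rightarrow> (real \<Rightarrow> real) set" where
  "W0_space L p = {u. continuous_on {0..L} u \<and> u \<in> Lp_space L p \<and>
     (\<exists>v\<in>Lp_space L p. has_weak_derivative L u v \<and>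
        (\<forall>\<epsilon>>0. \<exists>\<psi>\<in>test_functions L.
           sobolev_norm L p (\<lambda>x. u x - \<psi> x) (\<lambda>x. v x - deriv \<psi> x) < \<epsilon>))}"

definition W0_tendsto :: "real \<Rightarrow> real \<Rightarrow> (nat \<Rightarrow> real \<Rightarrow> real) \<Rightarrow> (real \<Rightarrow> real) \<Rightarrow> bool" where
  "W0_tendsto L p us u \<longleftrightarrow> u \<in> W0_space L p \<and> (\<forall>n. us n \<in> W0_space L p) \<and>
     (\<exists>v vs. v \<in> Lp_space L p \<and> has_weak_derivative L u v \<and>
        (\<forall>n. vs n \<in> Lp_space L p \<and> has_weak_derivative L (us n) (vs n)) \<and>
        (\<lambda>n. sobolev_norm L p (\<lambda>x. us n x - u x) (\<lambda>x. vs n x - v x)) \<longlonglongrightarrow> 0)"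

text \<open>The identity tested with a function whose weak derivative is \<open>dz\<close>; \<open>du\<close> is the weak derivative
  of \<open>u\<close>.\<close>

definition weak_identity ::
  "real \<Rightarrow> (real \<Rightarrow> real) \<Rightarrow> (real \<Rightarrow> real) \<Rightarrow> (real \<Rightarrow> ereal) \<Rightarrow>
   (real \<Rightarrow> real) \<Rightarrow> (real \<Rightarrow> real) \<Rightarrow> (real \<Rightarrow> real) \<Rightarrow> bool" where
  "weak_identity L a g \<phi> u du dz \<longleftrightarrow>
     (LINT x|leb_interval L. a x * du x * dz x) =
     (LINT x|leb_interval L. real_of_ereal (\<phi> (u x)) * dz x) +
     (LINT x|leb_interval L. g x * dz x)"

text \<open>In the case of exponent 1 the test functions \<open>z\<close> are Lipschitz, so their weak derivative
  exists and has a representative in \<open>Linf_space L\<close>.\<close>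

definition weak_solution_1 ::
  "real \<Rightarrow> (real \<Rightarrow> real) \<Rightarrow> (real \<Rightarrow> real) \<Rightarrow> (real \<Rightarrow> ereal) \<Rightarrow> (real \<Rightarrow> real) \<Rightarrow> bool" where
  "weak_solution_1 L a g \<phi> u \<longleftrightarrow>
     u \<in> W0_space L 1 \<and> (\<lambda>x. \<phi> (u x)) \<in> Lp_space_ereal L 1 \<and>
     (\<exists>du\<in>Lp_space L 1. has_weak_derivative L u du \<and>
        (\<forall>z. (\<exists>K. K-lipschitz_on {0..L} z) \<and> z 0 = 0 \<and> z L = 0 \<longrightarrow>
           (\<forall>dz\<in>Linf_space L. has_weak_derivative L z dz \<longrightarrow> weak_identity L a g \<phi> u du dz)))"

definition weak_solution_m ::
  "real \<Rightarrow> real \<Rightarrow> (real \<Rightarrow> real) \<Rightarrow> (real \<Rightarrow> real) \<Rightarrow> (real \<Rightarrow> ereal) \<Rightarrow> (real \<Rightarrow> real) \<Rightarrow> bool" where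
  "weak_solution_m L m a g \<phi> u \<longleftrightarrow>
     u \<in> W0_space L m \<and> (\<lambda>x. \<phi> (u x)) \<in> Lp_space_ereal L m \<and>
     (\<exists>du\<in>Lp_space L m. has_weak_derivative L u du \<and>
        (\<forall>z\<in>W0_space L (m / (m - 1)). \<forall>dz\<in>Lp_space L (m / (m - 1)).
           has_weak_derivative L z dz \<longrightarrow> weak_identity L a g \<phi> u du dz))"

definition weak_solution ::
  "real \<Rightarrow> real \<Rightarrow> (real \<Rightarrow> real) \<Rightarrow> (real \<Rightarrow> real) \<Rightarrow> (real \<Rightarrow> ereal) \<Rightarrow> (real \<Rightarrow> real) \<Rightarrow> bool" where
  "weak_solution L m a g \<phi> u \<longleftrightarrow>
     (if m = 1 then weak_solution_1 L a g \<phi> u else weak_solution_m L m a g \<phi> u)"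

text \<open>Functions with values in \<open>\<real> \<union> {+\<infinity>}\<close>, which carries the subspace topology of \<^typ>\<open>ereal\<close>.\<close>

definition admissible_nonlinearity :: "(real \<Rightarrow> ereal) \<Rightarrow> bool" where
  "admissible_nonlinearity \<phi> \<longleftrightarrow>
     (\<forall>s. \<phi> s \<noteq> -\<infinity>) \<and> continuous_on UNIV \<phi> \<and> (\<forall>s. s \<noteq> 0 \<longrightarrow> \<phi> s < \<infinity>)"

definition reasonable_approximations :: "(nat \<Rightarrow> real \<Rightarrow> ereal) \<Rightarrow> (real \<Rightarrow> ereal) \<Rightarrow> bool" where
  "reasonable_approximations \<phi>s \<phi> \<longleftrightarrow>
     (\<forall>n. admissible_nonlinearity (\<phi>s n)) \<and>
     (\<forall>t s. t \<longlonglongrightarrow> s \<longrightarrow> (\<lambda>n. \<phi>s n (t n)) \<longlonglongrightarrow> \<phi> s)"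

end

(* Wherever u_n differs from u, phi(u_n) has to stay bounded. Since phi(u) is integrable, phi(u(x0)) is
   finite at some x0 in (0,L), and phi is then bounded near u(x0); so we take u_n = u + w/(n+1) for a
   small smooth bump w supported near x0. The equation determines
     g_n = g + a w'/(n+1) - (phi_n(u_n) - phi(u)).
   The domination condition bounds phi_n(u_n) by a multiple of |phi(u)| plus a constant, so dominated
   convergence gives g_n -> g in L^m. *)
theory Submission
  imports Defs "HOL-Computational_Algebra.Polynomial"
begin

section \<open>A smooth bump function\<close>

text \<open>The obstacle is a possible singularity \<open>\<phi> 0 = \<infinity>\<close>: even a
  tiny displacement of \<open>u\<close> may bring it close to 0 on a set of positive measure and
  destroy the integrability of \<open>\<phi>\<close> along the new function. Being different from
  \<open>u\<close> requires only a local change, so it can be made where \<open>\<phi>\<close> is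
  harmless. The equation itself is no restriction, because the datum is free. Whenever the displaced
  function lies in \<open>W0_space\<close> and the new nonlinearity along it is in L^m, the choice
  of datum that leaves the flux balance \<open>a u' - \<phi>(u) - g\<close> unchanged turns it into
  a solution. The bump has to be infinitely differentiable because \<open>W0_space\<close> is a
  closure of smooth compactly supported functions: adding such a function to \<open>u\<close> shifts
  all its approximants by the same amount, which settles membership. The bump is therefore built
  from \<open>exp (- (1 / x))\<close>, and all its derivatives are controlled at once through a
  class of functions stable under differentiation.\<close>

definition flat :: "real poly \<Rightarrow> real \<Rightarrow> real" where
  "flat p x = (if x > 0 then poly p (1 / x) * exp (- (1 / x)) else 0)"

lemma poly_times_exp_minus_tendsto_0:
  fixes p :: "real poly"
  shows "((\<lambda>y. poly p y * exp (- y)) \<longlongrightarrow> 0) at_top"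
proof -
  have "((\<lambda>y::real. \<Sum>i\<le>degree p. coeff p i * (y ^ i / exp y)) \<longlongrightarrow> (\<Sum>i\<le>degree p. coeff p i * 0)) at_top"
    by (intro tendsto_intros tendsto_power_div_exp_0)
  then show ?thesis
    by (simp add: poly_altdef sum_distrib_right exp_minus divide_inverse mult.assoc)
qed

text \<open>With y = 1/x the chain rule gives y^2 (p(y) - p'(y)) exp(-y), and
  \<open>[:0, 0, 1:]\<close> is the polynomial y^2. Allowing an arbitrary polynomial factor thus
  makes the family \<open>flat\<close> stable under differentiation. At 0 the exponential beats
  every polynomial, so the one-sided derivatives are both 0.\<close>

lemma flat_has_real_derivative:
  "(flat p has_real_derivative flat ([:0, 0, 1:] * (p - pderiv p)) x) (at x)"
proof -
  consider "x > 0" | "x < 0" | "x = 0" by linarith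
  then show ?thesis
  proof cases
    case 1
    have "((\<lambda>x. poly p (1 / x) * exp (- (1 / x))) has_real_derivative
        flat ([:0, 0, 1:] * (p - pderiv p)) x) (at x)"
    proof (rule DERIV_cong)
      have inv: "((\<lambda>x. 1 / x) has_real_derivative - 1 / x\<^sup>2) (at x)"
        using 1 by (auto intro!: derivative_eq_intros simp: power2_eq_square)
      show "((\<lambda>x. poly p (1 / x) * exp (- (1 / x))) has_real_derivative
          poly p (1 / x) * (exp (- (1 / x)) * - (- 1 / x\<^sup>2))
          + poly (pderiv p) (1 / x) * (- 1 / x\<^sup>2) * exp (- (1 / x))) (at x)"
        by (intro DERIV_mult' DERIV_chain2[OF poly_DERIV inv] DERIV_chain2[OF DERIV_exp] DERIV_minus inv)
      show "poly p (1 / x) * (exp (- (1 / x)) * - (- 1 / x\<^sup>2))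
          + poly (pderiv p) (1 / x) * (- 1 / x\<^sup>2) * exp (- (1 / x))
          = flat ([:0, 0, 1:] * (p - pderiv p)) x"
        using 1 by (simp add: flat_def power2_eq_square divide_inverse algebra_simps)
    qed
    then show ?thesis
      by (rule has_field_derivative_transform_within_open[where S = "{0<..}"])
        (use 1 in \<open>auto simp: flat_def\<close>)
  next
    case 2
    have "((\<lambda>x. 0) has_real_derivative flat ([:0, 0, 1:] * (p - pderiv p)) x) (at x)"
      using 2 by (simp add: flat_def)
    then show ?thesis
      by (rule has_field_derivative_transform_within_open[where S = "{..<0}"])
        (use 2 in \<open>auto simp: flat_def\<close>)
  next
    case 3
    \<comment> \<open>\<open>pCons 0 p\<close> is y p(y); the extra factor y = 1/h is the
      denominator of the difference quotient at 0.\<close>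
    have "((\<lambda>h. poly (pCons 0 p) (inverse h) * exp (- inverse h)) \<longlongrightarrow> 0) (at_right 0)"
      using filterlim_compose[OF poly_times_exp_minus_tendsto_0 filterlim_inverse_at_top_right] .
    then have "((\<lambda>h. flat p h / h) \<longlongrightarrow> 0) (at_right 0)"
      by (rule Lim_transform_eventually)
        (auto simp: eventually_at_filter flat_def field_simps)
    moreover have "((\<lambda>h. flat p h / h) \<longlongrightarrow> 0) (at_left 0)"
      by (rule Lim_transform_eventually[OF tendsto_const])
        (auto simp: eventually_at_filter flat_def)
    ultimately have "((\<lambda>h. flat p h / h) \<longlongrightarrow> 0) (at 0)"
      by (simp add: filterlim_split_at)
    then show ?thesis
      using 3 by (simp add: DERIV_def flat_def)
  qed
qed

text \<open>A single product does not suffice, since the Leibniz rule produces two terms. Finite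
  sums of such products are stable under differentiation, so every iterated derivative of a bump
  stays in the class and is again differentiable.\<close>

inductive bump_derivative :: "real \<Rightarrow> real \<Rightarrow> (real \<Rightarrow> real) \<Rightarrow> bool" for c d where
  prod: "bump_derivative c d (\<lambda>x. flat p (x - c) * flat q (d - x))"
| add: "bump_derivative c d f \<Longrightarrow> bump_derivative c d g \<Longrightarrow> bump_derivative c d (\<lambda>x. f x + g x)"

lemma bump_derivative_closed:
  assumes "bump_derivative c d f"
  shows "\<exists>g. bump_derivative c d g \<and> (\<forall>x. (f has_real_derivative g x) (at x))"
  using assms
proof induction
  case (prod p q)
  let ?D = "\<lambda>p. [:0, 0, 1:] * (p - pderiv p)"
  \<comment> \<open>The inner derivative -1 of \<open>d - x\<close> is absorbed into the polynomial,
    so that the second Leibniz term is again a generator of the class.\<close>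
  have neg: "flat (- r) y = - flat r y" for r y
    by (simp add: flat_def)
  have "((\<lambda>x. flat p (x - c) * flat q (d - x)) has_real_derivative
      flat (?D p) (x - c) * flat q (d - x) + flat p (x - c) * flat (- ?D q) (d - x)) (at x)" for x
    unfolding neg
    by (auto intro!: derivative_eq_intros DERIV_chain'[OF _ flat_has_real_derivative] simp del: mult_pCons_left)
  then show ?case
    by (intro exI[of _ "\<lambda>x. flat (?D p) (x - c) * flat q (d - x) + flat p (x - c) * flat (- ?D q) (d - x)"])
      (auto intro!: bump_derivative.intros simp del: mult_pCons_left)
next
  case (add f g)
  then obtain f' g' where "bump_derivative c d f'" "\<forall>x. (f has_real_derivative f' x) (at x)"
    "bump_derivative c d g'" "\<forall>x. (g has_real_derivative g' x) (at x)" by blast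
  then show ?case
    by (intro exI[of _ "\<lambda>x. f' x + g' x"]) (auto intro!: bump_derivative.intros derivative_intros)
qed

lemma bump_derivative_funpow:
  assumes "bump_derivative c d f"
  shows "bump_derivative c d ((deriv ^^ k) f)"
proof (induction k)
  case (Suc k)
  then obtain g where "bump_derivative c d g" "\<forall>x. ((deriv ^^ k) f has_real_derivative g x) (at x)"
    using bump_derivative_closed by blast
  moreover from this have "deriv ((deriv ^^ k) f) = g"
    by (auto intro: DERIV_imp_deriv)
  ultimately show ?case by simp
qed (use assms in simp)

text \<open>The classical bump exp(-1/(x-c)) exp(-1/(d-x)) on (c,d), with both polynomials equal to
  1. The bound by 1 will limit the displacement of the solution, and the nonvanishing inside (c,d)
  will make the displaced function a different one.\<close>

lemma test_function_bump:
  assumes "0 < c" "c < d" "d < L"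
  obtains w where "w \<in> test_functions L" "\<And>x. 0 \<le> w x \<and> w x \<le> 1"
    "\<And>x. x \<notin> {c<..<d} \<Longrightarrow> w x = 0" "\<And>x. x \<in> {c<..<d} \<Longrightarrow> w x \<noteq> 0"
proof
  let ?w = "\<lambda>x. flat 1 (x - c) * flat 1 (d - x)"
  have "(deriv ^^ k) ?w differentiable (at x)" for k x
    using bump_derivative_closed[OF bump_derivative_funpow[OF bump_derivative.prod[of c d 1 1]]]
      real_differentiable_def by blast
  moreover have zero: "?w x = 0" if "x \<notin> {c<..<d}" for x
    using that by (auto simp: flat_def)
  moreover have "compact {c..d} \<and> {c..d} \<subseteq> {0<..<L} \<and> (\<forall>x. x \<notin> {c..d} \<longrightarrow> ?w x = 0)"
    using assms by (intro conjI allI impI zero) auto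
  ultimately show "?w \<in> test_functions L"
    unfolding test_functions_def by blast
  show "?w x = 0" if "x \<notin> {c<..<d}" for x by (fact zero[OF that])
  show "?w x \<noteq> 0" if "x \<in> {c<..<d}" for x
    using that by (auto simp: flat_def)
  have "0 \<le> flat 1 y" "flat 1 y \<le> 1" for y by (auto simp: flat_def)
  then show "0 \<le> ?w x \<and> ?w x \<le> 1" for x by (auto intro: mult_le_one)
qed

section \<open>Test functions\<close>

lemma test_function_has_derivative:
  assumes "\<psi> \<in> test_functions L"
  shows "(\<psi> has_real_derivative deriv \<psi> x) (at x)"
    and "(deriv \<psi> has_real_derivative deriv (deriv \<psi>) x) (at x)"
proof -
  have "(deriv ^^ k) \<psi> differentiable (at x)" for k
    using assms by (auto simp: test_functions_def)
  from this[of 0] this[of 1] show "(\<psi> has_real_derivative deriv \<psi> x) (at x)"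
    "(deriv \<psi> has_real_derivative deriv (deriv \<psi>) x) (at x)"
    by (auto simp: DERIV_deriv_iff_real_differentiable)
qed

lemma test_function_continuous:
  assumes "\<psi> \<in> test_functions L"
  shows "continuous_on S \<psi>" and "continuous_on S (deriv \<psi>)"
  using test_function_has_derivative[OF assms]
  by (meson DERIV_isCont continuous_at_imp_continuous_on)+

text \<open>The complement of a compact \<open>K\<close> is open, so the function vanishes near each
  of its points and its derivative does too. One \<open>K\<close> for both makes both integrals in
  the weak derivative converge.\<close>

lemma test_function_support:
  assumes "\<psi> \<in> test_functions L"
  obtains K where "compact K" "K \<subseteq> {0<..<L}" "\<And>x. x \<notin> K \<Longrightarrow> \<psi> x = 0" "\<And>x. x \<notin> K \<Longrightarrow> deriv \<psi> x = 0"
proof -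
  from assms obtain K where K: "compact K" "K \<subseteq> {0<..<L}" "\<And>x. x \<notin> K \<Longrightarrow> \<psi> x = 0"
    by (auto simp: test_functions_def)
  have "deriv \<psi> x = 0" if "x \<notin> K" for x
  proof (rule DERIV_imp_deriv)
    show "(\<psi> has_real_derivative 0) (at x)"
      by (rule has_field_derivative_transform_within_open[where S = "- K" and f = "\<lambda>_. 0"])
        (use that K compact_imp_closed in auto)
  qed
  with K that show thesis by blast
qed

text \<open>\<open>deriv\<close> is additive only where both functions are differentiable, so
  linearity of the k-th derivative is proved by induction on k, using the differentiability of all
  orders that test functions have.\<close>

lemma test_functions_add_scaled:
  assumes "\<psi> \<in> test_functions L" "w \<in> test_functions L"
  shows "(\<lambda>x. \<psi> x + c * w x) \<in> test_functions L"
    and "deriv (\<lambda>x. \<psi> x + c * w x) = (\<lambda>x. deriv \<psi> x + c * deriv w x)"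
proof -
  have diff: "(deriv ^^ k) \<psi> field_differentiable (at x)" "(deriv ^^ k) w field_differentiable (at x)" for k x
    using assms by (auto simp: test_functions_def field_differentiable_def real_differentiable_def)
  have eq: "(deriv ^^ k) (\<lambda>x. \<psi> x + c * w x) = (\<lambda>x. (deriv ^^ k) \<psi> x + c * (deriv ^^ k) w x)" for k
  proof (induction k)
    case (Suc k)
    have "deriv (\<lambda>x. (deriv ^^ k) \<psi> x + c * (deriv ^^ k) w x) x
        = deriv ((deriv ^^ k) \<psi>) x + c * deriv ((deriv ^^ k) w) x" for x
      using diff by (subst deriv_add) (auto intro!: field_differentiable_mult)
    then show ?case by (simp add: Suc)
  qed simp
  from eq[of 1] show "deriv (\<lambda>x. \<psi> x + c * w x) = (\<lambda>x. deriv \<psi> x + c * deriv w x)" by simp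
  obtain K1 K2 where "compact K1" "K1 \<subseteq> {0<..<L}" "\<And>x. x \<notin> K1 \<Longrightarrow> \<psi> x = 0"
    "compact K2" "K2 \<subseteq> {0<..<L}" "\<And>x. x \<notin> K2 \<Longrightarrow> w x = 0"
    using assms by (metis test_function_support)
  then have "\<exists>K. compact K \<and> K \<subseteq> {0<..<L} \<and> (\<forall>x. x \<notin> K \<longrightarrow> \<psi> x + c * w x = 0)"
    by (intro exI[of _ "K1 \<union> K2"]) auto
  moreover have "(deriv ^^ k) (\<lambda>x. \<psi> x + c * w x) differentiable (at x)" for k x
    unfolding eq using assms by (auto simp: test_functions_def)
  ultimately show "(\<lambda>x. \<psi> x + c * w x) \<in> test_functions L"
    by (auto simp: test_functions_def)
qed

lemma test_functions_scaled:
  assumes "w \<in> test_functions L"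
  shows "(\<lambda>x. c * w x) \<in> test_functions L" and "deriv (\<lambda>x. c * w x) = (\<lambda>x. c * deriv w x)"
  using test_functions_add_scaled[OF assms assms, of "c - 1"] by (simp_all add: algebra_simps)

section \<open>Lebesgue spaces on an interval\<close>

lemma Lp_space_dominated:
  assumes "f \<in> borel_measurable (leb_interval L)" "h \<in> Lp_space L p" "p \<ge> 0"
    and "AE x in leb_interval L. \<bar>f x\<bar> \<le> \<bar>h x\<bar>"
  shows "f \<in> Lp_space L p"
proof -
  have "integrable (leb_interval L) (\<lambda>x. \<bar>f x\<bar> powr p)"
  proof (rule Bochner_Integration.integrable_bound)
    show "integrable (leb_interval L) (\<lambda>x. \<bar>h x\<bar> powr p)"
      using assms by (simp add: Lp_space_def)
    show "AE x in leb_interval L. norm (\<bar>f x\<bar> powr p) \<le> norm (\<bar>h x\<bar> powr p)"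
      using assms(4) by eventually_elim (use assms(3) in \<open>auto intro: powr_mono2\<close>)
  qed (use assms(1) in measurable)
  with assms show ?thesis by (simp add: Lp_space_def)
qed

lemma Lp_space_scaled:
  assumes "f \<in> Lp_space L p"
  shows "(\<lambda>x. c * f x) \<in> Lp_space L p"
  using assms by (auto simp: Lp_space_def abs_mult powr_mult)

lemma Lp_space_add:
  assumes "f \<in> Lp_space L p" "h \<in> Lp_space L p" "p \<ge> 0"
  shows "(\<lambda>x. f x + h x) \<in> Lp_space L p"
proof -
  have meas: "f \<in> borel_measurable (leb_interval L)" "h \<in> borel_measurable (leb_interval L)"
    using assms by (auto simp: Lp_space_def)
  have "integrable (leb_interval L) (\<lambda>x. \<bar>f x + h x\<bar> powr p)"
  proof (rule Bochner_Integration.integrable_bound)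
    show "integrable (leb_interval L) (\<lambda>x. 2 powr p * (\<bar>f x\<bar> powr p + \<bar>h x\<bar> powr p))"
      using assms by (auto simp: Lp_space_def)
    \<comment> \<open>Estimating by the maximum gives a crude constant, but works for every p \<ge>
      0, without convexity; only membership is at stake, not a triangle inequality for the
      norm.\<close>
    have "\<bar>s + t\<bar> powr p \<le> 2 powr p * (\<bar>s\<bar> powr p + \<bar>t\<bar> powr p)" for s t :: real
    proof -
      have "\<bar>s + t\<bar> powr p \<le> (2 * max \<bar>s\<bar> \<bar>t\<bar>) powr p"
        using assms(3) by (intro powr_mono2) auto
      also have "\<dots> = 2 powr p * max \<bar>s\<bar> \<bar>t\<bar> powr p"
        by (simp add: powr_mult)
      also have "\<dots> \<le> 2 powr p * (\<bar>s\<bar> powr p + \<bar>t\<bar> powr p)"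
        by (intro mult_left_mono) (auto simp: max_def)
      finally show ?thesis .
    qed
    then show "AE x in leb_interval L. norm (\<bar>f x + h x\<bar> powr p)
        \<le> norm (2 powr p * (\<bar>f x\<bar> powr p + \<bar>h x\<bar> powr p))"
      by simp
  qed (use meas in measurable)
  with meas show ?thesis by (simp add: Lp_space_def)
qed

lemma Lp_space_diff:
  assumes "f \<in> Lp_space L p" "h \<in> Lp_space L p" "p \<ge> 0"
  shows "(\<lambda>x. f x - h x) \<in> Lp_space L p"
  using Lp_space_add[OF assms(1) Lp_space_scaled[OF assms(2), of "-1"] assms(3)] by simp

lemma finite_measure_leb_interval: "finite_measure (leb_interval L)"
  by (rule finite_measure_lebesgue_on) (simp add: lmeasurable_interval)

lemma Lp_space_bounded:
  assumes "f \<in> borel_measurable (leb_interval L)" "p \<ge> 0" "AE x in leb_interval L. \<bar>f x\<bar> \<le> K"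
  shows "f \<in> Lp_space L p"
proof (rule Lp_space_dominated[of _ _ "\<lambda>_. K"])
  interpret finite_measure "leb_interval L" by (rule finite_measure_leb_interval)
  show "(\<lambda>_. K) \<in> Lp_space L p"
    by (simp add: Lp_space_def)
  show "AE x in leb_interval L. \<bar>f x\<bar> \<le> \<bar>K\<bar>"
    using assms(3) by eventually_elim linarith
qed (use assms in auto)

text \<open>The codomain is left general because the lemma also serves extended-real compositions
  such as \<open>\<phi>s n\<close> along a displaced solution, which may take the value
  \<open>\<infinity>\<close>.\<close>

lemma continuous_on_measurable_leb_interval:
  fixes f :: "real \<Rightarrow> 'a::topological_space"
  assumes "continuous_on {0..L} f"
  shows "f \<in> borel_measurable (leb_interval L)"
proof -
  have "continuous_on {0<..<L} f"
    using assms by (rule continuous_on_subset) auto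
  then have "f \<in> borel_measurable (restrict_space borel {0<..<L})"
    by (rule borel_measurable_continuous_on_restrict)
  then show ?thesis
    by (auto simp: measurable_def space_restrict_space sets_restrict_space)
qed

lemma Lp_space_continuous:
  assumes "continuous_on {0..L} f" "p \<ge> 0"
  shows "f \<in> Lp_space L p"
proof -
  have "bounded (f ` {0..L})"
    by (intro compact_imp_bounded compact_continuous_image assms compact_Icc)
  then obtain K where "\<forall>x\<in>{0..L}. norm (f x) \<le> K"
    by (auto simp: bounded_iff)
  then show ?thesis
    using assms by (intro Lp_space_bounded[where K = K] continuous_on_measurable_leb_interval)
      (auto intro!: AE_I2)
qed

lemma Lp_norm_scaled:
  assumes "p > 0"
  shows "Lp_norm L p (\<lambda>x. c * f x) = \<bar>c\<bar> * Lp_norm L p f"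
  using assms by (simp add: Lp_norm_def abs_mult powr_mult powr_powr integral_nonneg_AE)

lemma integrable_Lp_mult_Linf:
  assumes "f \<in> Lp_space L 1" "h \<in> Linf_space L"
  shows "integrable (leb_interval L) (\<lambda>x. f x * h x)"
proof -
  from assms(2) obtain K where K: "AE x in leb_interval L. \<bar>h x\<bar> \<le> K"
    by (auto simp: Linf_space_def)
  have meas: "f \<in> borel_measurable (leb_interval L)" "h \<in> borel_measurable (leb_interval L)"
    using assms by (auto simp: Lp_space_def Linf_space_def)
  show ?thesis
  proof (rule Bochner_Integration.integrable_bound)
    show "integrable (leb_interval L) (\<lambda>x. K * (\<bar>f x\<bar> powr 1))"
      using assms by (auto simp: Lp_space_def)
    show "AE x in leb_interval L. norm (f x * h x) \<le> norm (K * (\<bar>f x\<bar> powr 1))"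
      using K
    proof eventually_elim
      case (elim x)
      then have "\<bar>f x\<bar> * \<bar>h x\<bar> \<le> \<bar>f x\<bar> * \<bar>K\<bar>"
        by (intro mult_left_mono) auto
      then show ?case by (simp add: abs_mult mult.commute)
    qed
  qed (use meas in measurable)
qed

text \<open>Young's inequality bounds the product pointwise by an integrable function; it applies
  since 1/m + (m-1)/m = 1. This is the pairing for exponents above 1, as
  \<open>integrable_Lp_mult_Linf\<close> is for exponent 1.\<close>

lemma integrable_Lp_mult_conjugate:
  assumes "f \<in> Lp_space L m" "h \<in> Lp_space L (m / (m - 1))" "m > 1"
  shows "integrable (leb_interval L) (\<lambda>x. f x * h x)"
proof -
  let ?q = "m / (m - 1)"
  have meas: "f \<in> borel_measurable (leb_interval L)" "h \<in> borel_measurable (leb_interval L)"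
    using assms by (auto simp: Lp_space_def)
  show ?thesis
  proof (rule Bochner_Integration.integrable_bound)
    show "integrable (leb_interval L) (\<lambda>x. \<bar>f x\<bar> powr m / m + \<bar>h x\<bar> powr ?q / ?q)"
      using assms by (auto simp: Lp_space_def)
    have "\<bar>s\<bar> * \<bar>t\<bar> \<le> \<bar>s\<bar> powr m / m + \<bar>t\<bar> powr ?q / ?q" for s t :: real
      using assms(3) by (intro Youngs_inequality) (auto simp: field_simps)
    then show "AE x in leb_interval L. norm (f x * h x)
        \<le> norm (\<bar>f x\<bar> powr m / m + \<bar>h x\<bar> powr ?q / ?q)"
      by (intro AE_I2) (metis abs_ge_self abs_mult order_trans real_norm_def)
  qed (use meas in measurable)
qed

lemma Lp_norm_tendsto_0_dominated:
  assumes "\<And>n. f n \<in> borel_measurable (leb_interval L)" "h \<in> Lp_space L p" "p > 0"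
    and bound: "\<And>n. AE x in leb_interval L. \<bar>f n x\<bar> \<le> \<bar>h x\<bar>"
    and lim: "AE x in leb_interval L. (\<lambda>n. f n x) \<longlonglongrightarrow> 0"
  shows "(\<lambda>n. Lp_norm L p (f n)) \<longlonglongrightarrow> 0"
proof -
  have "(\<lambda>n. LINT x|leb_interval L. \<bar>f n x\<bar> powr p) \<longlonglongrightarrow> (LINT x|leb_interval L. 0)"
  proof (rule integral_dominated_convergence)
    show "integrable (leb_interval L) (\<lambda>x. \<bar>h x\<bar> powr p)"
      using assms by (simp add: Lp_space_def)
    show "AE x in leb_interval L. norm (\<bar>f n x\<bar> powr p) \<le> \<bar>h x\<bar> powr p" for n
      using bound[of n] by eventually_elim (use assms(3) in \<open>auto intro: powr_mono2\<close>)
    show "AE x in leb_interval L. (\<lambda>n. \<bar>f n x\<bar> powr p) \<longlonglongrightarrow> 0"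
      using lim
    proof eventually_elim
      case (elim x)
      \<comment> \<open>The base tends to 0, where continuity of \<open>powr\<close> relies on a
        positive exponent and a nonnegative base.\<close>
      then have "(\<lambda>n. \<bar>f n x\<bar> powr p) \<longlonglongrightarrow> 0 powr p"
        using assms(3) by (intro tendsto_powr' tendsto_rabs_zero tendsto_const) auto
      then show ?case by simp
    qed
    show "(\<lambda>x. \<bar>f n x\<bar> powr p) \<in> borel_measurable (leb_interval L)" for n
      using assms(1)[of n] by measurable
  qed simp
  then have "(\<lambda>n. Lp_norm L p (f n)) \<longlonglongrightarrow> 0 powr (1 / p)"
    unfolding Lp_norm_def using assms(3)
    by (intro tendsto_powr' tendsto_const) (auto intro!: always_eventually integral_nonneg_AE)
  then show ?thesis by simp
qed

section \<open>Weak derivatives\<close>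

text \<open>On \<open>K\<close> the continuous factor is bounded, and outside it the product
  vanishes, so the local integrability of \<open>u\<close> on \<open>K\<close> is enough. Genuine
  integrability matters because the integral of a nonintegrable function is 0 by convention, and
  additivity may then fail.\<close>

lemma integrable_L1_loc_mult:
  assumes "u \<in> L1_loc L" "continuous_on UNIV \<eta>"
    and "compact K" "K \<subseteq> {0<..<L}" "\<And>x. x \<notin> K \<Longrightarrow> \<eta> x = 0"
  shows "integrable (leb_interval L) (\<lambda>x. u x * \<eta> x)"
proof -
  have int: "integrable lebesgue (\<lambda>x. indicator K x *\<^sub>R u x)"
    using assms by (auto simp: L1_loc_def set_integrable_def)
  have "bounded (\<eta> ` K)"
    using assms by (intro compact_imp_bounded compact_continuous_image) (auto intro: continuous_on_subset)
  then obtain B where B: "\<forall>x\<in>K. norm (\<eta> x) \<le> B"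
    by (auto simp: bounded_iff)
  have eq: "(\<lambda>x. u x * \<eta> x) = (\<lambda>x. indicator K x *\<^sub>R u x * \<eta> x)"
    using assms(5) by (auto simp: indicator_def fun_eq_iff)
  have "integrable lebesgue (\<lambda>x. u x * \<eta> x)"
  proof (rule Bochner_Integration.integrable_bound)
    show "integrable lebesgue (\<lambda>x. B * (indicator K x *\<^sub>R u x))"
      using int by simp
    have "\<eta> \<in> borel_measurable lebesgue"
      by (intro measurable_completion) (simp add: assms(2) borel_measurable_continuous_onI)
    then show "(\<lambda>x. u x * \<eta> x) \<in> borel_measurable lebesgue"
      unfolding eq using int by measurable
    have "norm (u x * \<eta> x) \<le> norm (B * (indicator K x *\<^sub>R u x))" for x
    proof (cases "x \<in> K")
      case True
      then have "\<bar>\<eta> x\<bar> \<le> \<bar>B\<bar>" using B by force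
      with True show ?thesis
        by (simp add: abs_mult mult.commute mult_right_mono)
    qed (use assms(5) in auto)
    then show "AE x in lebesgue. norm (u x * \<eta> x) \<le> norm (B * (indicator K x *\<^sub>R u x))"
      by simp
  qed
  then have "set_integrable lebesgue {0<..<L} (\<lambda>x. u x * \<eta> x)"
    unfolding set_integrable_def by (intro integrable_mult_indicator) auto
  then show ?thesis
    by (simp add: set_integrable_def integrable_restrict_space)
qed

lemma L1_loc_continuous:
  assumes "continuous_on {0..L} f"
  shows "f \<in> L1_loc L"
proof -
  have "set_integrable lebesgue K f" if "compact K" "K \<subseteq> {0<..<L}" for K
  proof -
    have "continuous_on K f"
      using assms by (rule continuous_on_subset) (use that in auto)
    then have "set_integrable lborel K f"
      using that by (intro borel_integrable_compact[unfolded set_integrable_def[symmetric]])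
    then show ?thesis
      unfolding set_integrable_def by (simp add: integrable_completion borel_measurable_integrable)
  qed
  then show ?thesis by (simp add: L1_loc_def)
qed

lemma has_weak_derivative_add_scaled:
  assumes "has_weak_derivative L u v" "has_weak_derivative L w y"
  shows "has_weak_derivative L (\<lambda>x. u x + c * w x) (\<lambda>x. v x + c * y x)"
  unfolding has_weak_derivative_def
proof (intro conjI ballI)
  have loc: "u \<in> L1_loc L" "v \<in> L1_loc L" "w \<in> L1_loc L" "y \<in> L1_loc L"
    using assms by (auto simp: has_weak_derivative_def)
  then show "(\<lambda>x. u x + c * w x) \<in> L1_loc L" "(\<lambda>x. v x + c * y x) \<in> L1_loc L"
    by (auto simp: L1_loc_def)
  fix \<psi> assume \<psi>: "\<psi> \<in> test_functions L"
  then obtain K where K: "compact K" "K \<subseteq> {0<..<L}" "\<And>x. x \<notin> K \<Longrightarrow> \<psi> x = 0"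
    "\<And>x. x \<notin> K \<Longrightarrow> deriv \<psi> x = 0"
    by (rule test_function_support) blast
  have int: "integrable (leb_interval L) (\<lambda>x. f x * \<psi> x)"
    "integrable (leb_interval L) (\<lambda>x. f x * deriv \<psi> x)" if "f \<in> L1_loc L" for f
    using K integrable_L1_loc_mult[OF that] test_function_continuous[OF \<psi>] by blast+
  have "(LINT x|leb_interval L. (u x + c * w x) * deriv \<psi> x)
      = (LINT x|leb_interval L. u x * deriv \<psi> x) + c * (LINT x|leb_interval L. w x * deriv \<psi> x)"
    using int loc by (simp add: distrib_right mult.assoc)
  also have "\<dots> = - (LINT x|leb_interval L. v x * \<psi> x) + c * - (LINT x|leb_interval L. y x * \<psi> x)"
    using assms \<psi> by (simp add: has_weak_derivative_def)
  also have "\<dots> = - (LINT x|leb_interval L. (v x + c * y x) * \<psi> x)"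
    using int loc by (simp add: distrib_right mult.assoc)
  finally show "(LINT x|leb_interval L. (u x + c * w x) * deriv \<psi> x)
      = - (LINT x|leb_interval L. (v x + c * y x) * \<psi> x)" .
qed

text \<open>Integration by parts: the integral of the derivative of \<open>w x * \<psi> x\<close>
  reduces to boundary values, which vanish because the support of \<open>\<psi>\<close> avoids 0 and
  \<open>L\<close>. For negative \<open>L\<close> the interval is empty and the integral is 0 as
  well.\<close>

lemma has_weak_derivative_test_function:
  assumes w: "w \<in> test_functions L"
  shows "has_weak_derivative L w (deriv w)"
  unfolding has_weak_derivative_def
proof (intro conjI ballI)
  show loc: "w \<in> L1_loc L" "deriv w \<in> L1_loc L"
    using test_function_continuous[OF w] by (auto intro: L1_loc_continuous)
  fix \<psi> assume \<psi>: "\<psi> \<in> test_functions L"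
  obtain K where K: "compact K" "K \<subseteq> {0<..<L}" "\<And>x. x \<notin> K \<Longrightarrow> \<psi> x = 0"
    "\<And>x. x \<notin> K \<Longrightarrow> deriv \<psi> x = 0"
    using \<psi> by (rule test_function_support) blast
  have int: "integrable (leb_interval L) (\<lambda>x. deriv w x * \<psi> x)"
    "integrable (leb_interval L) (\<lambda>x. w x * deriv \<psi> x)"
    using K integrable_L1_loc_mult loc test_function_continuous[OF \<psi>] by blast+
  have "(LINT x|leb_interval L. w x * deriv \<psi> x + deriv w x * \<psi> x) = 0"
  proof (cases "L \<ge> 0")
    case True
    have "((\<lambda>x. w x * deriv \<psi> x + deriv w x * \<psi> x) has_integral w L * \<psi> L - w 0 * \<psi> 0) {0..L}"
    proof (rule fundamental_theorem_of_calculus[OF True])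
      fix x
      have "((\<lambda>x. w x * \<psi> x) has_real_derivative w x * deriv \<psi> x + deriv w x * \<psi> x) (at x)"
        using DERIV_mult'[OF test_function_has_derivative(1)[OF w] test_function_has_derivative(1)[OF \<psi>]] .
      then show "((\<lambda>x. w x * \<psi> x) has_vector_derivative w x * deriv \<psi> x + deriv w x * \<psi> x) (at x within {0..L})"
        by (simp add: has_field_derivative_at_within flip: has_real_derivative_iff_has_vector_derivative)
    qed
    moreover have "\<psi> 0 = 0" "\<psi> L = 0" using K(2,3) by fastforce+
    ultimately have "((\<lambda>x. w x * deriv \<psi> x + deriv w x * \<psi> x) has_integral 0) {0<..<L}"
      using has_integral_Icc_iff_Ioo by fastforce
    moreover have "integral {0<..<L} (\<lambda>x. w x * deriv \<psi> x + deriv w x * \<psi> x)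
        = (LINT x|leb_interval L. w x * deriv \<psi> x + deriv w x * \<psi> x)"
      using int by (intro lebesgue_integral_eq_integral[symmetric]) auto
    ultimately show ?thesis by (simp add: integral_unique)
  next
    case False
    then have "space (leb_interval L) = {}" by simp
    then show ?thesis using Bochner_Integration.integral_empty by blast
  qed
  with int show "(LINT x|leb_interval L. w x * deriv \<psi> x) = - (LINT x|leb_interval L. deriv w x * \<psi> x)"
    by simp
qed

text \<open>If \<open>\<psi>\<close> approximates \<open>u\<close>, then \<open>\<psi> + c w\<close>
  approximates \<open>u + c w\<close> with exactly the same error, since the added terms cancel in
  the differences. No estimate of the Sobolev norm is involved.\<close>

lemma W0_space_add_scaled_test_function:
  assumes "u \<in> W0_space L p" "w \<in> test_functions L" "p \<ge> 0"
  shows "(\<lambda>x. u x + c * w x) \<in> W0_space L p"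
proof -
  from assms(1) obtain v where u: "continuous_on {0..L} u" "u \<in> Lp_space L p" and v: "v \<in> Lp_space L p"
    "has_weak_derivative L u v" and approx: "\<And>\<epsilon>. \<epsilon> > 0 \<Longrightarrow> \<exists>\<psi>\<in>test_functions L.
      sobolev_norm L p (\<lambda>x. u x - \<psi> x) (\<lambda>x. v x - deriv \<psi> x) < \<epsilon>"
    unfolding W0_space_def by blast
  have w: "w \<in> Lp_space L p" "deriv w \<in> Lp_space L p"
    using test_function_continuous[OF assms(2)] assms(3) by (auto intro: Lp_space_continuous)
  have "\<exists>\<psi>\<in>test_functions L. sobolev_norm L p (\<lambda>x. u x + c * w x - \<psi> x)
      (\<lambda>x. v x + c * deriv w x - deriv \<psi> x) < \<epsilon>" if pos: "\<epsilon> > 0" for \<epsilon>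
  proof -
    obtain \<psi> where \<psi>: "\<psi> \<in> test_functions L"
      "sobolev_norm L p (\<lambda>x. u x - \<psi> x) (\<lambda>x. v x - deriv \<psi> x) < \<epsilon>"
      using approx[OF pos] by blast
    then show ?thesis
      using test_functions_add_scaled[OF \<psi>(1) assms(2), of c]
      by (intro bexI[of _ "\<lambda>x. \<psi> x + c * w x"]) auto
  qed
  moreover have "has_weak_derivative L (\<lambda>x. u x + c * w x) (\<lambda>x. v x + c * deriv w x)"
    using v assms has_weak_derivative_add_scaled has_weak_derivative_test_function by blast
  moreover have "continuous_on {0..L} (\<lambda>x. u x + c * w x)"
    using u test_function_continuous[OF assms(2)] by (intro continuous_intros)
  moreover have "(\<lambda>x. u x + c * w x) \<in> Lp_space L p" "(\<lambda>x. v x + c * deriv w x) \<in> Lp_space L p"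
    using u v w assms(3) by (auto intro!: Lp_space_add Lp_space_scaled)
  ultimately show ?thesis
    unfolding W0_space_def by blast
qed

text \<open>With the weak derivatives \<open>v\<close> and \<open>v + c n * deriv w\<close>, the
  differences are exact multiples of \<open>w\<close> and \<open>deriv w\<close>, so the norm is
  \<open>\<bar>c n\<bar>\<close> times a fixed number.\<close>

lemma W0_tendsto_add_scaled_test_function:
  assumes "u \<in> W0_space L p" "w \<in> test_functions L" "p > 0" "c \<longlonglongrightarrow> 0"
  shows "W0_tendsto L p (\<lambda>n x. u x + c n * w x) u"
proof -
  from assms(1) obtain v where v: "v \<in> Lp_space L p" "has_weak_derivative L u v"
    unfolding W0_space_def by blast
  have w: "w \<in> Lp_space L p" "deriv w \<in> Lp_space L p"
    using test_function_continuous[OF assms(2)] assms(3) by (auto intro: Lp_space_continuous)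
  have "(\<lambda>n. \<bar>c n\<bar> * (Lp_norm L p w + Lp_norm L p (deriv w))) \<longlonglongrightarrow> 0"
    using assms(4) by (intro tendsto_mult_left_zero tendsto_rabs_zero)
  then have lim: "(\<lambda>n. sobolev_norm L p (\<lambda>x. u x + c n * w x - u x) (\<lambda>x. v x + c n * deriv w x - v x)) \<longlonglongrightarrow> 0"
    using assms(3) by (simp add: sobolev_norm_def Lp_norm_scaled distrib_left)
  have "(\<lambda>x. v x + c n * deriv w x) \<in> Lp_space L p
      \<and> has_weak_derivative L (\<lambda>x. u x + c n * w x) (\<lambda>x. v x + c n * deriv w x)" for n
    using v w assms has_weak_derivative_add_scaled has_weak_derivative_test_function
    by (auto intro!: Lp_space_add Lp_space_scaled)
  with lim v show ?thesis
    unfolding W0_tendsto_def using assms W0_space_add_scaled_test_function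
    by (intro conjI allI exI[of _ v] exI[of _ "\<lambda>n x. v x + c n * deriv w x"]) auto
qed

section \<open>Perturbing a weak solution\<close>

lemma Lp_space_Linf_mult:
  assumes "a \<in> Linf_space L" "f \<in> Lp_space L p" "p \<ge> 0"
  shows "(\<lambda>x. a x * f x) \<in> Lp_space L p"
proof -
  from assms(1) obtain K where K: "AE x in leb_interval L. \<bar>a x\<bar> \<le> K"
    by (auto simp: Linf_space_def)
  have meas: "a \<in> borel_measurable (leb_interval L)" "f \<in> borel_measurable (leb_interval L)"
    using assms by (auto simp: Lp_space_def Linf_space_def)
  show ?thesis
  proof (rule Lp_space_dominated[OF _ Lp_space_scaled[OF assms(2), of K] assms(3)])
    show "AE x in leb_interval L. \<bar>a x * f x\<bar> \<le> \<bar>K * f x\<bar>"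
      using K by eventually_elim (auto simp: abs_mult intro!: mult_right_mono)
  qed (use meas in measurable)
qed

text \<open>The new datum is chosen so that the integrand a (du + dw) - \<psi>(v) - datum equals a
  du - \<phi>(u) - g pointwise. The assumption \<open>pair\<close> abstracts the duality between L^m
  and the derivatives of the test functions, so one computation covers both notions of solution. It
  provides the integrability that splitting the integrals requires.\<close>

lemma weak_identity_perturbed:
  assumes pair: "\<And>f. f \<in> Lp_space L m \<Longrightarrow> integrable (leb_interval L) (\<lambda>x. f x * dz x)"
    and "m \<ge> 0" "a \<in> Linf_space L" "g \<in> Lp_space L m" "du \<in> Lp_space L m" "dw \<in> Lp_space L m"
    and "(\<lambda>x. \<phi> (u x)) \<in> Lp_space_ereal L m" "(\<lambda>x. \<psi> (v x)) \<in> Lp_space_ereal L m"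
    and "weak_identity L a g \<phi> u du dz"
  shows "weak_identity L a (\<lambda>x. g x + (a x * dw x - (real_of_ereal (\<psi> (v x)) - real_of_ereal (\<phi> (u x)))))
    \<psi> v (\<lambda>x. du x + dw x) dz"
proof -
  let ?I = "\<lambda>f. LINT x|leb_interval L. f x * dz x"
  have int: "integrable (leb_interval L) (\<lambda>x. g x * dz x)"
    "integrable (leb_interval L) (\<lambda>x. a x * du x * dz x)"
    "integrable (leb_interval L) (\<lambda>x. a x * dw x * dz x)"
    "integrable (leb_interval L) (\<lambda>x. real_of_ereal (\<phi> (u x)) * dz x)"
    "integrable (leb_interval L) (\<lambda>x. real_of_ereal (\<psi> (v x)) * dz x)"
    using assms by (auto intro!: pair Lp_space_Linf_mult simp: Lp_space_ereal_def)
  show ?thesis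
    using assms(9) int unfolding weak_identity_def
    by (simp add: distrib_left distrib_right left_diff_distrib)
qed

text \<open>The new nonlinearity enters only through its integrability along the displaced function;
  the datum compensates for everything else. The two cases differ just in the pairing: L^1 with
  bounded derivatives, or L^m with the conjugate exponent.\<close>

lemma weak_solution_perturbed:
  assumes "weak_solution L m a g \<phi> u" "m \<ge> 1" "a \<in> Linf_space L" "g \<in> Lp_space L m"
    and w: "w \<in> test_functions L"
    and \<psi>: "(\<lambda>x. \<psi> (u x + c * w x)) \<in> Lp_space_ereal L m"
  shows "weak_solution L m a (\<lambda>x. g x + (a x * (c * deriv w x)
      - (real_of_ereal (\<psi> (u x + c * w x)) - real_of_ereal (\<phi> (u x))))) \<psi> (\<lambda>x. u x + c * w x)"
proof -
  have dw: "(\<lambda>x. c * deriv w x) \<in> Lp_space L m"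
    using test_function_continuous[OF w] assms(2) by (auto intro!: Lp_space_scaled Lp_space_continuous)
  have wd: "has_weak_derivative L (\<lambda>x. u x + c * w x) (\<lambda>x. du x + c * deriv w x)"
    if "has_weak_derivative L u du" for du
    using that w has_weak_derivative_add_scaled has_weak_derivative_test_function by blast
  have m0: "m \<ge> 0" using assms(2) by simp
  show ?thesis
  proof (cases "m = 1")
    case True
    have sol: "weak_solution_1 L a g \<phi> u"
      using assms(1) True by (simp add: weak_solution_def)
    then obtain du where du: "du \<in> Lp_space L 1" "has_weak_derivative L u du"
      and ident: "\<And>z dz. (\<exists>K. K-lipschitz_on {0..L} z) \<and> z 0 = 0 \<and> z L = 0 \<Longrightarrow> dz \<in> Linf_space L \<Longrightarrow>
        has_weak_derivative L z dz \<Longrightarrow> weak_identity L a g \<phi> u du dz"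
      unfolding weak_solution_1_def by blast
    have "u \<in> W0_space L 1" and phi: "(\<lambda>x. \<phi> (u x)) \<in> Lp_space_ereal L 1"
      using sol by (auto simp: weak_solution_1_def)
    then have "(\<lambda>x. u x + c * w x) \<in> W0_space L 1"
      using w by (intro W0_space_add_scaled_test_function) auto
    moreover have "(\<lambda>x. du x + c * deriv w x) \<in> Lp_space L 1"
      using du dw True by (intro Lp_space_add) auto
    ultimately show ?thesis
      unfolding weak_solution_def if_P[OF True] weak_solution_1_def
      using \<psi> dw m0 assms(3,4) du phi
      by (intro conjI bexI[of _ "\<lambda>x. du x + c * deriv w x"] allI impI ballI wd
          weak_identity_perturbed[where m = 1] integrable_Lp_mult_Linf ident)
        (auto simp: True)
  next
    case False
    then have m1: "m > 1" using assms(2) by simp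
    have sol: "weak_solution_m L m a g \<phi> u"
      using assms(1) False by (simp add: weak_solution_def)
    then obtain du where du: "du \<in> Lp_space L m" "has_weak_derivative L u du"
      and ident: "\<And>z dz. z \<in> W0_space L (m / (m - 1)) \<Longrightarrow> dz \<in> Lp_space L (m / (m - 1)) \<Longrightarrow>
        has_weak_derivative L z dz \<Longrightarrow> weak_identity L a g \<phi> u du dz"
      unfolding weak_solution_m_def by blast
    have "u \<in> W0_space L m" and phi: "(\<lambda>x. \<phi> (u x)) \<in> Lp_space_ereal L m"
      using sol by (auto simp: weak_solution_m_def)
    then have "(\<lambda>x. u x + c * w x) \<in> W0_space L m"
      using w m0 by (intro W0_space_add_scaled_test_function) auto
    moreover have "(\<lambda>x. du x + c * deriv w x) \<in> Lp_space L m"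
      using du dw m0 by (intro Lp_space_add) auto
    ultimately show ?thesis
      unfolding weak_solution_def if_not_P[OF False] weak_solution_m_def
      using \<psi> dw m0 m1 assms(3,4) du phi
      by (intro conjI bexI[of _ "\<lambda>x. du x + c * deriv w x"] allI impI ballI wd
          weak_identity_perturbed[where m = m] integrable_Lp_mult_conjugate ident)
        auto
  qed
qed

section \<open>Choice of a displacement along which the nonlinearity stays bounded\<close>

text \<open>Continuity into the extended reals makes the preimage of (r - 1, r + 1) an open
  neighbourhood of \<open>s0\<close>, where r is the finite value there. The point
  \<open>s0 = 0\<close> is allowed, provided the value at it is finite.\<close>

lemma admissible_locally_bounded:
  assumes "admissible_nonlinearity \<phi>" "\<phi> s0 \<noteq> \<infinity>"
  obtains \<delta> M where "\<delta> > 0" "\<And>s. \<bar>s - s0\<bar> < \<delta> \<Longrightarrow> \<bar>\<phi> s\<bar> \<le> ereal M"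
proof -
  obtain r where r: "\<phi> s0 = ereal r"
    using assms by (cases "\<phi> s0") (auto simp: admissible_nonlinearity_def)
  have "open (\<phi> -` {ereal (r - 1)<..<ereal (r + 1)})"
    using assms(1) by (intro open_vimage) (auto simp: admissible_nonlinearity_def)
  moreover have "s0 \<in> \<phi> -` {ereal (r - 1)<..<ereal (r + 1)}"
    by (simp add: r)
  ultimately obtain \<delta> where \<delta>: "\<delta> > 0" "ball s0 \<delta> \<subseteq> \<phi> -` {ereal (r - 1)<..<ereal (r + 1)}"
    by (rule openE)
  have "\<bar>\<phi> s\<bar> \<le> ereal (\<bar>r\<bar> + 1)" if "\<bar>s - s0\<bar> < \<delta>" for s
  proof -
    have "s \<in> ball s0 \<delta>" using that by (simp add: dist_real_def abs_minus_commute)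
    with \<delta>(2) have "\<phi> s \<in> {ereal (r - 1)<..<ereal (r + 1)}" by blast
    then show ?thesis by (cases "\<phi> s") auto
  qed
  with \<delta>(1) that show thesis by blast
qed

text \<open>The bound is uniform in \<open>t\<close>, so one \<open>w\<close> and one
  \<open>M\<close> serve all members of the sequence. The first alternative covers the points where
  \<open>w\<close> vanishes, the second the region around a point of finiteness.\<close>

lemma bump_perturbation_bounded:
  assumes "L > 0" "admissible_nonlinearity \<phi>" "continuous_on {0..L} u"
    and fin: "AE x in leb_interval L. \<bar>\<phi> (u x)\<bar> \<noteq> \<infinity>"
  obtains w M where "w \<in> test_functions L" "\<exists>x\<in>{0..L}. w x \<noteq> 0"
    "\<And>x t. 0 \<le> t \<Longrightarrow> t \<le> 1 \<Longrightarrow> \<phi> (u x + t * w x) = \<phi> (u x) \<or> \<bar>\<phi> (u x + t * w x)\<bar> \<le> ereal M"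
proof -
  have "\<exists>x\<in>{0<..<L}. \<bar>\<phi> (u x)\<bar> \<noteq> \<infinity>"
  proof (rule ccontr)
    assume "\<not> ?thesis"
    \<comment> \<open>Were \<open>\<phi> (u x)\<close> infinite throughout, the exceptional null set
      would be the whole interval, whose measure is \<open>L > 0\<close>.\<close>
    then have "emeasure (leb_interval L) {0<..<L} = 0"
      using fin by (subst (asm) AE_iff_measurable[where N = "{0<..<L}"]) auto
    then show False using assms(1) by (simp add: emeasure_restrict_space)
  qed
  then obtain x0 where x0: "0 < x0" "x0 < L" "\<phi> (u x0) \<noteq> \<infinity>" by auto
  obtain \<delta> M where \<delta>: "\<delta> > 0" and M: "\<And>s. \<bar>s - u x0\<bar> < \<delta> \<Longrightarrow> \<bar>\<phi> s\<bar> \<le> ereal M"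
    using admissible_locally_bounded[OF assms(2) x0(3)] by blast
  obtain e where e: "e > 0" "\<And>x. x \<in> {0..L} \<Longrightarrow> \<bar>x - x0\<bar> < e \<Longrightarrow> \<bar>u x - u x0\<bar> < \<delta> / 2"
    using assms(3)[unfolded continuous_on_iff, rule_format, of x0 "\<delta> / 2"] x0 \<delta>
    by (auto simp: dist_real_def)
  \<comment> \<open>Halving makes r strictly smaller than each of the three quantities, so the
    closed interval around \<open>x0\<close> lies in (0,L) and within the radius
    \<open>e\<close>.\<close>
  define r where "r = min e (min x0 (L - x0)) / 2"
  have r: "r > 0" "r < e" "r < x0" "r < L - x0"
    using e(1) x0 by (auto simp: r_def min_def)
  obtain w where w: "w \<in> test_functions L" "\<And>x. 0 \<le> w x \<and> w x \<le> 1"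
    "\<And>x. x \<notin> {x0 - r<..<x0 + r} \<Longrightarrow> w x = 0" "\<And>x. x \<in> {x0 - r<..<x0 + r} \<Longrightarrow> w x \<noteq> 0"
    by (rule test_function_bump[of "x0 - r" "x0 + r" L]) (use r in auto)
  show thesis
  proof
    \<comment> \<open>The budget \<open>\<delta>\<close> is split evenly: one half for the
      oscillation of \<open>u\<close> near \<open>x0\<close>, one half for the displacement, which
      is at most \<open>\<delta> / 2\<close> because \<open>w\<close> is at most 1.\<close>
    show "(\<lambda>x. \<delta> / 2 * w x) \<in> test_functions L"
      using w(1) by (rule test_functions_scaled)
    show "\<exists>x\<in>{0..L}. \<delta> / 2 * w x \<noteq> 0"
      using w(4)[of x0] r x0 \<delta> by (intro bexI[of _ x0]) auto
    fix x t :: real assume t: "0 \<le> t" "t \<le> 1"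
    show "\<phi> (u x + t * (\<delta> / 2 * w x)) = \<phi> (u x) \<or> \<bar>\<phi> (u x + t * (\<delta> / 2 * w x))\<bar> \<le> ereal M"
    proof (cases "x \<in> {x0 - r<..<x0 + r}")
      case True
      have "t * w x \<le> 1" "0 \<le> t * w x" using t w(2)[of x] by (auto intro: mult_le_one)
      then have "\<delta> / 2 * (t * w x) \<le> \<delta> / 2" "0 \<le> \<delta> / 2 * (t * w x)"
        using \<delta> by (auto intro: mult_left_le)
      moreover have "\<bar>u x - u x0\<bar> < \<delta> / 2"
        using True r by (intro e(2)) auto
      ultimately have "\<bar>u x + t * (\<delta> / 2 * w x) - u x0\<bar> < \<delta>"
        unfolding mult.left_commute[of t "\<delta> / 2"] by linarith
      then show ?thesis using M by blast
    qed (use w(3) in simp)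
  qed
qed

text \<open>To be read at a point x with p = \<phi>(u), q = \<phi>(u_n) and y = \<phi>_n(u_n).
  Finiteness of \<open>y\<close> is a separate conclusion because \<open>real_of_ereal\<close> maps
  infinite values to 0, so a bound on the real part alone would not exclude them. The absolute
  values of \<open>C\<close> and \<open>M\<close> appear since their signs are unspecified.\<close>

lemma dominated_real_of_ereal:
  assumes "\<bar>p\<bar> \<noteq> \<infinity>" "q = p \<or> \<bar>q\<bar> \<le> ereal M" "\<bar>y\<bar> \<le> ereal C * \<bar>q\<bar>"
  shows "\<bar>y\<bar> \<noteq> \<infinity>" and "\<bar>real_of_ereal y\<bar> \<le> \<bar>C\<bar> * (\<bar>real_of_ereal p\<bar> + \<bar>M\<bar>)"
proof -
  obtain s where q: "q = ereal s"
    using assms(1,2) by (cases q) auto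
  then have s: "\<bar>s\<bar> \<le> \<bar>real_of_ereal p\<bar> + \<bar>M\<bar>"
    using assms(2) by (cases p) (auto simp: q)
  obtain t where y: "y = ereal t"
    using assms(3) q by (cases y) auto
  have "\<bar>t\<bar> \<le> C * \<bar>s\<bar>"
    using assms(3) q y by simp
  also have "\<dots> \<le> \<bar>C\<bar> * (\<bar>real_of_ereal p\<bar> + \<bar>M\<bar>)"
    using s by (intro mult_mono) auto
  finally show "\<bar>real_of_ereal y\<bar> \<le> \<bar>C\<bar> * (\<bar>real_of_ereal p\<bar> + \<bar>M\<bar>)"
    by (simp add: y)
  show "\<bar>y\<bar> \<noteq> \<infinity>" by (simp add: y)
qed

section \<open>Construction of the data and solutions, and their convergence\<close>

theorem proposition3p7:
  fixes L m \<alpha> \<beta> :: real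
    and a g u :: "real \<Rightarrow> real"
    and \<phi> :: "real \<Rightarrow> ereal"
    and \<phi>s :: "nat \<Rightarrow> real \<Rightarrow> ereal"
  assumes "L > 0" and "m \<ge> 1"
    and "a \<in> Linf_space L"
    and "0 < \<alpha>" and "\<alpha> < \<beta>"
    and "AE x in leb_interval L. \<alpha> \<le> a x \<and> a x \<le> \<beta>"
    and "g \<in> Lp_space L m"
    and "admissible_nonlinearity \<phi>"
    and "weak_solution L m a g \<phi> u"
    and "reasonable_approximations \<phi>s \<phi>"
    and "\<exists>C::real. \<forall>s n. \<bar>\<phi>s n s\<bar> \<le> ereal C * \<bar>\<phi> s\<bar>"
  shows "\<exists>gs us. (\<forall>n. gs n \<in> Lp_space L m) \<and>
           (\<lambda>n. Lp_norm L m (\<lambda>x. gs n x - g x)) \<longlonglongrightarrow> 0 \<and>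
           (\<forall>n. weak_solution L m a (gs n) (\<phi>s n) (us n)) \<and>
           (\<forall>n. \<exists>x\<in>{0..L}. us n x \<noteq> u x) \<and>
           W0_tendsto L m us u"
proof -
  have m0: "m \<ge> 0" "m > 0" using assms(2) by auto
  have u: "u \<in> W0_space L m" "(\<lambda>x. \<phi> (u x)) \<in> Lp_space_ereal L m"
    using assms(9) by (auto simp: weak_solution_def weak_solution_1_def weak_solution_m_def split: if_splits)
  then have cont: "continuous_on {0..L} u" and fin: "AE x in leb_interval L. \<bar>\<phi> (u x)\<bar> \<noteq> \<infinity>"
    and phi: "(\<lambda>x. real_of_ereal (\<phi> (u x))) \<in> Lp_space L m"
    by (auto simp: W0_space_def Lp_space_ereal_def)
  obtain w M where w: "w \<in> test_functions L" "\<exists>x\<in>{0..L}. w x \<noteq> 0" and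
    M: "\<And>x t. 0 \<le> t \<Longrightarrow> t \<le> 1 \<Longrightarrow> \<phi> (u x + t * w x) = \<phi> (u x) \<or> \<bar>\<phi> (u x + t * w x)\<bar> \<le> ereal M"
    using bump_perturbation_bounded[OF assms(1,8) cont fin] by blast
  obtain C where C: "\<And>s n. \<bar>\<phi>s n s\<bar> \<le> ereal C * \<bar>\<phi> s\<bar>" using assms(11) by blast
  \<comment> \<open>Starting at 1 keeps the factor positive, so every displaced function differs
    from \<open>u\<close>, and at most 1, so the uniform bound \<open>M\<close> applies to all
    indices including 0.\<close>
  define c where "c n = inverse (real (Suc n))" for n
  have c: "0 < c n" "c n \<le> 1" for n
    by (auto simp: c_def field_simps)
  have c_lim: "c \<longlonglongrightarrow> 0"
    unfolding c_def by (rule LIMSEQ_inverse_real_of_nat)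
  define us where "us n x = u x + c n * w x" for n x
  define F where "F n x = real_of_ereal (\<phi>s n (us n x))" for n x
  define f where "f n x = a x * (c n * deriv w x) - (F n x - real_of_ereal (\<phi> (u x)))" for n x
  \<comment> \<open>\<open>B\<close> majorizes every \<open>F n\<close>, and \<open>h\<close> every
    \<open>f n\<close>, almost everywhere and independently of n; the factor
    \<open>c n \<le> 1\<close> is simply dropped.\<close>
  define B where "B x = \<bar>C\<bar> * (\<bar>real_of_ereal (\<phi> (u x))\<bar> + \<bar>M\<bar>)" for x
  define h where "h x = \<bar>a x * deriv w x\<bar> + (B x + \<bar>real_of_ereal (\<phi> (u x))\<bar>)" for x
  have abs_Lp: "(\<lambda>x. \<bar>q x\<bar>) \<in> Lp_space L m" if "q \<in> Lp_space L m" for q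
    using that by (auto simp: Lp_space_def)
  have aw: "(\<lambda>x. a x * deriv w x) \<in> Lp_space L m"
    using test_function_continuous[OF w(1)] m0 by (intro Lp_space_Linf_mult Lp_space_continuous assms)
  have B: "B \<in> Lp_space L m"
    unfolding B_def using m0
    by (intro Lp_space_scaled Lp_space_add abs_Lp[OF phi] Lp_space_continuous continuous_on_const)
  have h: "h \<in> Lp_space L m"
    unfolding h_def using m0 B phi aw by (intro Lp_space_add abs_Lp)
  \<comment> \<open>\<open>real_of_ereal\<close> jumps at \<open>\<infinity>\<close>, so
    \<open>F n\<close> need not be continuous. Measurability comes from a continuous extended-real
    function followed by a Borel map.\<close>
  have F_meas: "F n \<in> borel_measurable (leb_interval L)" for n
  proof -
    have "continuous_on UNIV (\<phi>s n)"
      using assms(10) by (auto simp: reasonable_approximations_def admissible_nonlinearity_def)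
    then have "continuous_on {0..L} (\<lambda>x. \<phi>s n (us n x))"
      unfolding us_def
      by (rule continuous_on_compose2) (auto intro!: continuous_intros cont test_function_continuous[OF w(1)])
    then show ?thesis
      unfolding F_def by (intro borel_measurable_real_of_ereal continuous_on_measurable_leb_interval)
  qed
  have F_bound: "\<bar>\<phi>s n (us n x)\<bar> \<noteq> \<infinity>" "\<bar>F n x\<bar> \<le> B x" if "\<bar>\<phi> (u x)\<bar> \<noteq> \<infinity>" for n x
    using dominated_real_of_ereal[OF that M C] c[of n] unfolding F_def B_def us_def by auto
  have B_nonneg: "B x \<ge> 0" for x
    unfolding B_def by (intro mult_nonneg_nonneg add_nonneg_nonneg abs_ge_zero)
  have F_Lp: "F n \<in> Lp_space L m" for n
    using fin F_bound B_nonneg by (intro Lp_space_dominated[OF F_meas B m0(1)]) (auto elim!: eventually_mono)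
  have F_ereal: "(\<lambda>x. \<phi>s n (us n x)) \<in> Lp_space_ereal L m" for n
  proof -
    have "AE x in leb_interval L. \<bar>\<phi>s n (us n x)\<bar> \<noteq> \<infinity>"
      using fin by eventually_elim (rule F_bound(1))
    then show ?thesis
      using F_Lp[of n] unfolding Lp_space_ereal_def F_def by blast
  qed
  have f_Lp: "f n \<in> Lp_space L m" for n
    using Lp_space_scaled[OF aw, of "c n"] F_Lp phi m0 unfolding f_def
    by (intro Lp_space_diff) (auto simp: mult.left_commute)
  have "(\<lambda>n. Lp_norm L m (f n)) \<longlonglongrightarrow> 0"
  proof (rule Lp_norm_tendsto_0_dominated[OF _ h m0(2)])
    show "f n \<in> borel_measurable (leb_interval L)" for n
      using f_Lp by (simp add: Lp_space_def)
    show "AE x in leb_interval L. \<bar>f n x\<bar> \<le> \<bar>h x\<bar>" for n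
      using fin
    proof eventually_elim
      case (elim x)
      have "\<bar>a x * (c n * deriv w x)\<bar> = c n * \<bar>a x * deriv w x\<bar>"
        using c[of n] by (simp add: abs_mult)
      also have "\<dots> \<le> \<bar>a x * deriv w x\<bar>"
        using c[of n] by (intro mult_left_le_one_le) auto
      finally show ?case
        using F_bound(2)[OF elim, of n] unfolding f_def h_def by linarith
    qed
    show "AE x in leb_interval L. (\<lambda>n. f n x) \<longlonglongrightarrow> 0"
      using fin
    proof eventually_elim
      case (elim x)
      have "(\<lambda>n. us n x) \<longlonglongrightarrow> u x + 0 * w x"
        unfolding us_def by (intro tendsto_intros c_lim)
      \<comment> \<open>Here the approximation hypothesis is needed along moving arguments: both the
        nonlinearity and the point at which it is evaluated vary with n.\<close>
      then have "(\<lambda>n. \<phi>s n (us n x)) \<longlonglongrightarrow> \<phi> (u x)"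
        using assms(10) by (simp add: reasonable_approximations_def)
      \<comment> \<open>Passing to real parts is legitimate because the limit
        \<open>\<phi> (u x)\<close> is finite, which holds for almost every x.\<close>
      then have "(\<lambda>n. F n x) \<longlonglongrightarrow> real_of_ereal (\<phi> (u x))"
        unfolding F_def using elim by (intro lim_real_of_ereal) (simp add: ereal_real)
      then have "(\<lambda>n. f n x) \<longlonglongrightarrow> a x * (0 * deriv w x) - (real_of_ereal (\<phi> (u x)) - real_of_ereal (\<phi> (u x)))"
        unfolding f_def by (intro tendsto_intros c_lim)
      then show ?case by simp
    qed
  qed
  moreover have "weak_solution L m a (\<lambda>x. g x + f n x) (\<phi>s n) (us n)" for n
    using weak_solution_perturbed[OF assms(9,2,3,7) w(1) F_ereal[of n, unfolded us_def]]
    unfolding f_def F_def us_def .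
  moreover have "W0_tendsto L m us u"
    unfolding us_def by (intro W0_tendsto_add_scaled_test_function u w m0 c_lim)
  \<comment> \<open>Both functions are continuous representatives, so a single point of difference
    already makes them distinct as elements of the Sobolev space.\<close>
  moreover have "\<exists>x\<in>{0..L}. us n x \<noteq> u x" for n
    using w(2) c(1)[of n] unfolding us_def by auto
  moreover have "(\<lambda>x. g x + f n x) \<in> Lp_space L m" for n
    using f_Lp assms(7) m0 by (intro Lp_space_add)
  ultimately show ?thesis
    by (intro exI[of _ "\<lambda>n x. g x + f n x"] exI[of _ us]) simp
qed

end
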